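(* Let $f:\mathbb{R}^m\times\mathbb{R}^n\to\mathbb{R}$ be two times differentiable with $L$-Lipschitz continuous Hessian, let $\eta>0$, and assume that $\eta\|D_{xx}^2 f(x,y)\|\le 1/18$ and $\eta\|D_{yy}^2 f(x,y)\|\le 1/18$ for all $(x,y)\in\mathbb{R}^{m+n}$. Let $(x_0,y_0)\in\mathbb{R}^m\times\mathbb{R}^n$ and $\alpha>0$, and assume that for all $(x,y)\in\mathbb{R}^{m+n}$, with $D_{xx}^2f$, $D_{yy}^2 f$, $\bar D$, $\tilde D$ evaluated at $(x,y)$, $$2\eta\, h_{\pm}\!\left(D_{xx}^2 f\right)+\tfrac13\bar D-32\eta^2L\left(\|\nabla_x f(x_0,y_0)\|+\|\nabla_y f(x_0,y_0)\|\right)-768\eta^4L^2\succeq\alpha\operatorname{Id},$$ $$2\eta\, h_{\pm}\!\left(-D_{yy}^2 f\right)+\tfrac13\tilde D-32\eta^2L\left(\|\nabla_x f(x_0,y_0)\|+\|\nabla_y f(x_0,y_0)\|\right)-768\eta^4L^2\succeq\alpha\operatorname{Id}.$$ Then competitive gradient descent (CGD) with stepsize $\eta$ for the zero-sum game $\min_x f$, $\min_y(-f)$, started in $(x_0,y_0)$, converges at exponential rate with exponent $\alpha$ to a critical point of $f$; that is, the iterates $(x_k,y_k)$ converge to a point $(x^*,y^* )$ with $\nabla_x f(x^*,y^* )=0$ and $\nabla_y f(x^*,y^* )=0$, and there is a constant $C$ such that $\|\nabla_x f(x_k,y_k)\|^2+\|\nabla_y f(x_k,y_k)\|^2\le C e^{-\alpha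 k}$ for all $k\ge 0$.
   Context: $\nabla_x f,\nabla_y f$ are the partial gradients. $D_{xx}^2 f$, $D_{yy}^2 f$ are the diagonal blocks of the Hessian of $f$, $D_{xy}^2 f$ is the $m\times n$ block with entries $\partial^2 f/\partial x_i\partial y_j$, and $D_{yx}^2 f=(D_{xy}^2 f)^{\top}$. Vector norms are Euclidean and matrix norms are the induced spectral norms; $\succeq$ is the Loewner order. Define $$\bar D=(\operatorname{Id}+\eta^2 D_{xy}^2 f\,D_{yx}^2 f)^{-1}\eta^2 D_{xy}^2 f\,D_{yx}^2 f,\qquad \tilde D=(\operatorname{Id}+\eta^2 D_{yx}^2 f\,D_{xy}^2 f)^{-1}\eta^2 D_{yx}^2 f\,D_{xy}^2 f.$$ Let $\phi(\lambda)=2\lambda-|\lambda|$ and $h_{\pm}(\lambda)=\phi(\lambda)/2=\min(3\lambda,\lambda)/2$. These are spectral functions: applied to a symmetric matrix, $h_\pm$ acts on the eigenvalues, keeping the eigenvectors. Scalars appearing in sums with matrices are understood as multiples of the identity. CGD with stepsize $\eta$ for the zero-sum game is the iteration (derivatives evaluated at $(x_k,y_k)$) $$x_{k+1}=x_k-\eta\left(\operatorname{Id}+\eta^2 D_{xy}^2 f\,D_{yx}^2 f\right)^{-1}\left(\nabla_x f+\eta D_{xy}^2 f\,\nabla_y f\right),$$ $$y_{k+1}=y_k-\eta\left(\operatorname{Id}+\eta^2 D_{yx}^2 f\,D_{xy}^2 f\right)^{-1}\left(-\nabla_y f+\eta D_{yx}^2 f\,\nabla_x f\right).$$ *)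

theory Defs
  imports "HOL-Analysis.Analysis"
begin

text \<open>Meaningful only where the function is (Frechet) differentiable.\<close>
definition gradient :: "('a::real_inner \<Rightarrow> real) \<Rightarrow> 'a \<Rightarrow> 'a" where
  "gradient g z = (THE D. GDERIV g z :> D)"

text \<open>The Hessian at a point, as a linear operator. On a product space the norm is the
  Euclidean one, so \<^const>\<open>onorm\<close> is the spectral norm of the Hessian.\<close>
definition hess :: "('a::real_inner \<Rightarrow> real) \<Rightarrow> 'a \<Rightarrow> 'a \<Rightarrow> 'a" where
  "hess g z = frechet_derivative (gradient g) (at z)"

definition twice_differentiable :: "('a::real_inner \<Rightarrow> real) \<Rightarrow> bool" where
  "twice_differentiable g \<longleftrightarrow>
     (\<forall>z. g differentiable (at z)) \<and> (\<forall>z. gradient g differentiable (at z))"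

definition lipschitz_hessian :: "real \<Rightarrow> ('a::real_inner \<Rightarrow> real) \<Rightarrow> bool" where
  "lipschitz_hessian L g \<longleftrightarrow>
     (\<forall>z w. onorm (\<lambda>v. hess g z v - hess g w v) \<le> L * dist z w)"

definition grad_x :: "((real^'m) \<times> (real^'n) \<Rightarrow> real) \<Rightarrow> (real^'m) \<times> (real^'n) \<Rightarrow> real^'m" where
  "grad_x f z = gradient (\<lambda>x. f (x, snd z)) (fst z)"

definition grad_y :: "((real^'m) \<times> (real^'n) \<Rightarrow> real) \<Rightarrow> (real^'m) \<times> (real^'n) \<Rightarrow> real^'n" where
  "grad_y f z = gradient (\<lambda>y. f (fst z, y)) (snd z)"

definition Dxx :: "((real^'m) \<times> (real^'n) \<Rightarrow> real) \<Rightarrow> (real^'m) \<times> (real^'n) \<Rightarrow> real^'m^'m" where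
  "Dxx f z = (\<chi> i j. (axis i 1, 0) \<bullet> hess f z (axis j 1, 0))"

definition Dyy :: "((real^'m) \<times> (real^'n) \<Rightarrow> real) \<Rightarrow> (real^'m) \<times> (real^'n) \<Rightarrow> real^'n^'n" where
  "Dyy f z = (\<chi> i j. (0, axis i 1) \<bullet> hess f z (0, axis j 1))"

text \<open>Entry (i, j) is the second partial derivative of f in the i-th x-coordinate and the
  j-th y-coordinate; the library type of a matrix with rows indexed by 'm and columns
  indexed by 'n is \<^typ>\<open>real^'n^'m\<close>.\<close>
definition Dxy :: "((real^'m) \<times> (real^'n) \<Rightarrow> real) \<Rightarrow> (real^'m) \<times> (real^'n) \<Rightarrow> real^'n^'m" where
  "Dxy f z = (\<chi> i j. (axis i 1, 0) \<bullet> hess f z (0, axis j 1))"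

definition Dyx :: "((real^'m) \<times> (real^'n) \<Rightarrow> real) \<Rightarrow> (real^'m) \<times> (real^'n) \<Rightarrow> real^'m^'n" where
  "Dyx f z = transpose (Dxy f z)"

definition spectral_norm :: "real^'n^'m \<Rightarrow> real" where
  "spectral_norm A = onorm ((*v) A)"

text \<open>Meant for symmetric matrices, on which it is the usual semidefinite order.\<close>
definition loewner_ge :: "real^'n^'n \<Rightarrow> real^'n^'n \<Rightarrow> bool" (infix "\<succeq>" 50) where
  "A \<succeq> B \<longleftrightarrow> (\<forall>v. 0 \<le> v \<bullet> ((A - B) *v v))"

definition Dbar :: "real \<Rightarrow> ((real^'m) \<times> (real^'n) \<Rightarrow> real) \<Rightarrow> (real^'m) \<times> (real^'n) \<Rightarrow> real^'m^'m" where
  "Dbar \<eta> f z =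
     matrix_inv (mat 1 + \<eta>\<^sup>2 *\<^sub>R (Dxy f z ** Dyx f z)) ** (\<eta>\<^sup>2 *\<^sub>R (Dxy f z ** Dyx f z))"

definition Dtilde :: "real \<Rightarrow> ((real^'m) \<times> (real^'n) \<Rightarrow> real) \<Rightarrow> (real^'m) \<times> (real^'n) \<Rightarrow> real^'n^'n" where
  "Dtilde \<eta> f z =
     matrix_inv (mat 1 + \<eta>\<^sup>2 *\<^sub>R (Dyx f z ** Dxy f z)) ** (\<eta>\<^sup>2 *\<^sub>R (Dyx f z ** Dxy f z))"

definition phi :: "real \<Rightarrow> real" where
  "phi l = 2 * l - \<bar>l\<bar>"

definition h_pm :: "real \<Rightarrow> real" where
  "h_pm l = phi l / 2"

text \<open>The matrix with the eigenvectors of A in which every eigenvalue l is replaced by h l.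
  For symmetric A the eigenvectors span the space, so there is exactly one such matrix.\<close>
definition spectral_fun :: "(real \<Rightarrow> real) \<Rightarrow> real^'n^'n \<Rightarrow> real^'n^'n" where
  "spectral_fun h A = (THE B. \<forall>l v. A *v v = l *\<^sub>R v \<longrightarrow> B *v v = h l *\<^sub>R v)"

lemma spectral_fun_diagonalized:
  fixes A Q :: "real^'n^'n"
  assumes Q: "orthogonal_matrix Q"
    and A: "A = Q ** (\<chi> i j. if i = j then d i else 0) ** transpose Q"
  shows "spectral_fun h A = Q ** (\<chi> i j. if i = j then h (d i) else 0) ** transpose Q"
proof -
  define E :: "('n \<Rightarrow> real) \<Rightarrow> real^'n^'n" where "E = (\<lambda>d. \<chi> i j. if i = j then d i else 0)"
  have E: "(E d *v v) $ i = d i * v $ i" for d v i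
    by (simp add: E_def matrix_vector_mult_def if_distrib[where f = "\<lambda>t. t * _"] cong: if_cong)
  have Q1: "transpose Q *v (Q *v v) = v" and Q2: "Q *v (transpose Q *v v) = v" for v
    using Q by (simp_all add: matrix_vector_mul_assoc orthogonal_matrix_def del: transpose_matrix_vector)
  have AE: "A = Q ** E d ** transpose Q" using A by (simp add: E_def)
  define B where "B = Q ** E (\<lambda>i. h (d i)) ** transpose Q"
  have B: "B *v v = h l *\<^sub>R v" if "A *v v = l *\<^sub>R v" for l v
  proof -
    define w where "w = transpose Q *v v"
    have "E d *v w = transpose Q *v (A *v v)"
      by (simp add: AE w_def Q1 del: transpose_matrix_vector flip: matrix_vector_mul_assoc)
    also have "\<dots> = l *\<^sub>R w"
      by (simp add: that w_def matrix_vector_mult_scaleR del: transpose_matrix_vector)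
    finally have "d i * w $ i = l * w $ i" for i
      by (metis E vector_scaleR_component real_scaleR_def)
    then have "h (d i) * w $ i = h l * w $ i" for i
      by (metis mult_cancel_right)
    then have "E (\<lambda>i. h (d i)) *v w = h l *\<^sub>R w"
      by (simp add: vec_eq_iff E)
    then have "B *v v = Q *v (h l *\<^sub>R w)"
      by (simp add: B_def w_def del: transpose_matrix_vector flip: matrix_vector_mul_assoc)
    then show ?thesis
      by (simp add: matrix_vector_mult_scaleR w_def Q2 del: transpose_matrix_vector)
  qed
  have uniq: "C = B" if C: "\<forall>l v. A *v v = l *\<^sub>R v \<longrightarrow> C *v v = h l *\<^sub>R v" for C
  proof -
    have "C *v (Q *v axis i 1) = B *v (Q *v axis i 1)" for i
    proof -
      have "E d *v axis i 1 = d i *\<^sub>R axis i 1"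
        by (simp add: vec_eq_iff E axis_def)
      then have "A *v (Q *v axis i 1) = d i *\<^sub>R (Q *v axis i 1)"
        by (simp add: AE Q1 matrix_vector_mult_scaleR del: transpose_matrix_vector flip: matrix_vector_mul_assoc)
      then show ?thesis using C B by metis
    qed
    then have "column i (C ** Q) = column i (B ** Q)" for i
      by (metis matrix_vector_mul_assoc matrix_vector_mult_basis)
    then have "C ** Q = B ** Q"
      by (simp add: vec_eq_iff column_def)
    then have "C ** Q ** transpose Q = B ** Q ** transpose Q" by simp
    then show ?thesis
      using Q by (simp add: orthogonal_matrix_def flip: matrix_mul_assoc)
  qed
  have "spectral_fun h A = B"
    unfolding spectral_fun_def by (rule the_equality) (use B uniq in auto)
  then show ?thesis by (simp add: B_def E_def)
qed

definition cgd_step ::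
  "real \<Rightarrow> ((real^'m) \<times> (real^'n) \<Rightarrow> real) \<Rightarrow> (real^'m) \<times> (real^'n) \<Rightarrow> (real^'m) \<times> (real^'n)" where
  "cgd_step \<eta> f z =
     (fst z - \<eta> *\<^sub>R (matrix_inv (mat 1 + \<eta>\<^sup>2 *\<^sub>R (Dxy f z ** Dyx f z))
                   *v (grad_x f z + \<eta> *\<^sub>R (Dxy f z *v grad_y f z))),
      snd z - \<eta> *\<^sub>R (matrix_inv (mat 1 + \<eta>\<^sup>2 *\<^sub>R (Dyx f z ** Dxy f z))
                   *v (- grad_y f z + \<eta> *\<^sub>R (Dyx f z *v grad_x f z))))"

definition cgd ::
  "real \<Rightarrow> ((real^'m) \<times> (real^'n) \<Rightarrow> real) \<Rightarrow> (real^'m) \<times> (real^'n) \<Rightarrow> nat \<Rightarrow> (real^'m) \<times> (real^'n)" where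
  "cgd \<eta> f z0 k = (cgd_step \<eta> f ^^ k) z0"

end

theory Submission
  imports Defs
begin

text \<open>
  The proof shows that each step multiplies the squared gradient norm by at most
  \<open>1 - \<alpha> \<le> exp (- \<alpha>)\<close>. As the step length is at most \<open>\<eta>\<close> times the gradient norm, the steps are then
  summable, the iterates converge, and by continuity the gradient vanishes at the limit.

  The one-step estimate rests on the game-theoretic meaning of the update. Put \<open>N = \<eta> Dxy\<close>,
  let \<open>(u, v)\<close> be the gradient and \<open>\<eta> (a, b)\<close> the step. The matrix inverses in the update solve
  a two-player bilinear game with quadratic penalties on the moves, whose equilibrium conditions are \<open>a + N b = - u\<close> and
  \<open>b - N\<^sup>T a = v\<close> (\<open>cgd_direction\<close>). Hence, up to the Taylor remainder, the gradient after the step is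
  \<open>u + \<eta> Dxx a + N b = - (1 - \<eta> Dxx) a\<close> in the first and \<open>v + N\<^sup>T a + \<eta> Dyy b = (1 + \<eta> Dyy) b\<close>
  in the second component. The cross terms in \<open>|u|\<^sup>2 + |v|\<^sup>2\<close> cancel, so that the interaction
  contributes a gain \<open>|N b|\<^sup>2 + |N\<^sup>T a|\<^sup>2\<close> in passing from \<open>(u, v)\<close> to \<open>(a, b)\<close>
  (\<open>cgd_direction_energy\<close>), and this gain equals \<open>u \<bullet> Dbar u + v \<bullet> Dtilde v\<close>. The
  factors \<open>1 - \<eta> Dxx\<close> and \<open>1 + \<eta> Dyy\<close> are treated in eigencoordinates
  (\<open>symmetric_contraction\<close>): they produce the terms with \<^const>\<open>h_pm\<close>, evaluated at the gradient
  and not at \<open>(a, b)\<close>, at the cost of \<open>2 / 5\<close> of the gain (\<open>linearised_step_decrease\<close>).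
  Finally, the Lipschitz bound on the Hessian makes the Taylor remainder at most
  \<open>\<eta>\<^sup>2 L (|u|\<^sup>2 + |v|\<^sup>2)\<close>, which the terms with \<open>L\<close> in the curvature condition dominate
  (\<open>cgd_step_decrease\<close>).

  Two facts are needed on the way: the Hessian is symmetric (\<open>hess_symmetric\<close>),
  without which neither the block structure nor the spectral functions make sense, and symmetric
  matrices are orthogonally diagonalisable (\<open>symmetric_matrix_diagonalizable\<close>).
\<close>

section \<open>Gradient and Hessian of a twice differentiable function\<close>

lemma gderiv_gradient:
  fixes g :: "'a::euclidean_space \<Rightarrow> real"
  assumes "g differentiable (at z)"
  shows "GDERIV g z :> gradient g z"
proof -
  obtain g' where g': "(g has_derivative g') (at z)"
    using assms unfolding differentiable_def by blast
  define D where "D = (\<Sum>b\<in>Basis. g' b *\<^sub>R b)"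
  have "linear g'" using g' by (rule has_derivative_linear)
  have "g' h = h \<bullet> D" for h
  proof -
    have "g' h = g' (\<Sum>b\<in>Basis. (h \<bullet> b) *\<^sub>R b)" by (simp add: euclidean_representation)
    also have "\<dots> = (\<Sum>b\<in>Basis. (h \<bullet> b) * g' b)"
      using \<open>linear g'\<close> by (simp add: linear_sum linear_cmul)
    finally show ?thesis by (simp add: D_def inner_sum_right mult.commute)
  qed
  then have D: "GDERIV g z :> D"
    using g' unfolding gderiv_def by (metis (no_types, lifting) ext)
  have "E = D" if "GDERIV g z :> E" for E
  proof -
    have "(\<lambda>h. h \<bullet> E) = (\<lambda>h. h \<bullet> D)"
      using that D unfolding gderiv_def by (rule has_derivative_unique)
    then show ?thesis by (simp add: fun_eq_iff vector_eq_ldot)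
  qed
  with D show ?thesis unfolding gradient_def by (metis theI)
qed

lemma gradient_eqI:
  fixes g :: "'a::euclidean_space \<Rightarrow> real"
  assumes "GDERIV g z :> D"
  shows "gradient g z = D"
proof -
  have "g differentiable (at z)"
    using assms unfolding gderiv_def differentiable_def by blast
  then have "GDERIV g z :> gradient g z" by (rule gderiv_gradient)
  then have "(\<lambda>h. h \<bullet> gradient g z) = (\<lambda>h. h \<bullet> D)"
    using assms unfolding gderiv_def by (rule has_derivative_unique)
  then show ?thesis by (simp add: fun_eq_iff vector_eq_ldot)
qed

lemma grad_x_eq_fst_gradient:
  fixes f :: "(real^'m) \<times> (real^'n) \<Rightarrow> real"
  assumes "f differentiable (at z)"
  shows "grad_x f z = fst (gradient f z)"
  unfolding grad_x_def
proof (rule gradient_eqI)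
  have f': "(f has_derivative (\<lambda>h. h \<bullet> gradient f z)) (at (fst z, snd z))"
    using gderiv_gradient[OF assms] by (simp add: gderiv_def)
  have "((\<lambda>x. (x, snd z)) has_derivative (\<lambda>h. (h, 0))) (at (fst z))"
    by (auto intro!: derivative_eq_intros)
  from has_derivative_compose[OF this f']
  show "GDERIV (\<lambda>x. f (x, snd z)) (fst z) :> fst (gradient f z)"
    by (simp add: gderiv_def inner_prod_def)
qed

lemma grad_y_eq_snd_gradient:
  fixes f :: "(real^'m) \<times> (real^'n) \<Rightarrow> real"
  assumes "f differentiable (at z)"
  shows "grad_y f z = snd (gradient f z)"
  unfolding grad_y_def
proof (rule gradient_eqI)
  have f': "(f has_derivative (\<lambda>h. h \<bullet> gradient f z)) (at (fst z, snd z))"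
    using gderiv_gradient[OF assms] by (simp add: gderiv_def)
  have "((\<lambda>y. (fst z, y)) has_derivative (\<lambda>h. (0, h))) (at (snd z))"
    by (auto intro!: derivative_eq_intros)
  from has_derivative_compose[OF this f']
  show "GDERIV (\<lambda>y. f (fst z, y)) (snd z) :> snd (gradient f z)"
    by (simp add: gderiv_def inner_prod_def)
qed

lemma gradient_has_derivative_hess:
  "twice_differentiable g \<Longrightarrow> (gradient g has_derivative hess g z) (at z)"
  by (simp add: twice_differentiable_def hess_def frechet_derivative_works[symmetric])

lemma bounded_linear_hess: "twice_differentiable g \<Longrightarrow> bounded_linear (hess g z)"
  using gradient_has_derivative_hess has_derivative_bounded_linear by blast

lemma lipschitz_hessian_bound:
  assumes g: "twice_differentiable g" and L: "lipschitz_hessian L g"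
  shows "norm (hess g z v - hess g w v) \<le> L * dist z w * norm v"
proof -
  have "bounded_linear (\<lambda>v. hess g z v - hess g w v)"
    by (intro bounded_linear_sub bounded_linear_hess g)
  then have "norm (hess g z v - hess g w v) \<le> onorm (\<lambda>v. hess g z v - hess g w v) * norm v"
    by (rule onorm)
  also have "\<dots> \<le> L * dist z w * norm v"
    using L by (auto simp: lipschitz_hessian_def intro!: mult_right_mono)
  finally show ?thesis .
qed

lemma lipschitz_hessian_nonneg:
  fixes g :: "'a::euclidean_space \<Rightarrow> real"
  assumes g: "twice_differentiable g" and L: "lipschitz_hessian L g"
  shows "0 \<le> L"
proof -
  obtain b :: 'a where b: "b \<in> Basis" using nonempty_Basis by blast
  have "norm (hess g b b - hess g 0 b) \<le> L * dist b 0 * norm b"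
    using g L by (rule lipschitz_hessian_bound)
  also have "\<dots> = L" using b by simp
  finally show ?thesis using norm_ge_zero order_trans by blast
qed

text \<open>The mean value inequality for the gradient minus its linearisation at \<open>z\<close>, whose derivative is
  at most \<open>L * norm d\<close> on the ball that contains the segment.\<close>
lemma gradient_taylor:
  fixes g :: "'a::euclidean_space \<Rightarrow> real"
  assumes g: "twice_differentiable g" and L: "lipschitz_hessian L g"
  shows "norm (gradient g (z + d) - gradient g z - hess g z d) \<le> L * (norm d)\<^sup>2"
proof -
  define F where "F w = gradient g w - hess g z w" for w
  note lin = bounded_linear.linear[OF bounded_linear_hess[OF g]]
  have "norm (F (z + d) - F z) \<le> (L * norm d) * norm ((z + d) - z)"
  proof (rule differentiable_bound[where S = "cball z (norm d)"])
    fix w assume w: "w \<in> cball z (norm d)"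
    show "(F has_derivative (\<lambda>v. hess g w v - hess g z v)) (at w within cball z (norm d))"
      unfolding F_def
      by (intro has_derivative_diff has_derivative_at_withinI[OF gradient_has_derivative_hess[OF g]]
           bounded_linear_imp_has_derivative bounded_linear_hess g)
    have "onorm (\<lambda>v. hess g w v - hess g z v) \<le> L * dist w z"
      using L by (simp add: lipschitz_hessian_def)
    also have "\<dots> \<le> L * norm d"
      using w lipschitz_hessian_nonneg[OF g L] by (intro mult_left_mono) (auto simp: dist_commute)
    finally show "onorm (\<lambda>v. hess g w v - hess g z v) \<le> L * norm d" .
  qed (auto simp: dist_norm)
  then show ?thesis
    by (simp add: F_def linear_add[OF lin] power2_eq_square algebra_simps)
qed

text \<open>The mixed second difference along \<open>v\<close> and \<open>w\<close> is unchanged when \<open>v\<close> and \<open>w\<close> are exchanged,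
  whereas the bilinear form that it approximates is not visibly symmetric. This estimate is
  there to transfer the symmetry; it comes from the mean value theorem along \<open>v\<close> and the first
  order expansion of the gradient along \<open>w\<close>.\<close>
lemma second_difference_hess:
  fixes g :: "'a::euclidean_space \<Rightarrow> real"
  assumes g: "twice_differentiable g" and L: "lipschitz_hessian L g"
  shows "\<bar>g (z + v + w) - g (z + v) - g (z + w) + g z - v \<bullet> hess g z w\<bar>
           \<le> L * norm v * norm w * (norm v + norm w)"
proof -
  define \<phi> where "\<phi> s = g (z + s *\<^sub>R v + w) - g (z + s *\<^sub>R v)" for s
  have der: "DERIV \<phi> s :> v \<bullet> (gradient g (z + s *\<^sub>R v + w) - gradient g (z + s *\<^sub>R v))" for s
  proof -
    have D: "(g has_derivative (\<lambda>h. h \<bullet> gradient g y)) (at y)" for y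
      using g gderiv_gradient[of g y] by (simp add: twice_differentiable_def gderiv_def)
    have 1: "((\<lambda>s. z + s *\<^sub>R v + w) has_derivative (\<lambda>h. h *\<^sub>R v)) (at s)"
      and 2: "((\<lambda>s. z + s *\<^sub>R v) has_derivative (\<lambda>h. h *\<^sub>R v)) (at s)"
      by (auto intro!: derivative_eq_intros)
    show ?thesis
      unfolding has_field_derivative_def \<phi>_def[abs_def]
      by (rule has_derivative_eq_rhs[OF has_derivative_diff[OF has_derivative_compose[OF 1 D]
              has_derivative_compose[OF 2 D]]])
        (simp add: fun_eq_iff inner_diff_right algebra_simps)
  qed
  obtain \<xi> where \<xi>: "0 < \<xi>" "\<xi> < 1"
    and mvt: "\<phi> 1 - \<phi> 0 = (1 - 0) * (v \<bullet> (gradient g (z + \<xi> *\<^sub>R v + w) - gradient g (z + \<xi> *\<^sub>R v)))"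
    using MVT2[of 0 1 \<phi>, OF _ der] by auto
  define y where "y = z + \<xi> *\<^sub>R v"
  have L0: "0 \<le> L" using lipschitz_hessian_nonneg[OF g L] .
  have "norm (gradient g (y + w) - gradient g y - hess g z w)
      \<le> norm (gradient g (y + w) - gradient g y - hess g y w) + norm (hess g y w - hess g z w)"
    by norm
  also have "\<dots> \<le> L * (norm w)\<^sup>2 + L * dist y z * norm w"
    by (intro add_mono gradient_taylor lipschitz_hessian_bound g L)
  also have "\<dots> \<le> L * (norm w)\<^sup>2 + L * norm v * norm w"
    using \<xi> L0 by (auto simp: y_def dist_norm intro!: mult_right_mono mult_left_mono mult_left_le_one_le)
  finally have *: "norm (gradient g (y + w) - gradient g y - hess g z w) \<le> L * norm w * (norm v + norm w)"
    by (simp add: power2_eq_square algebra_simps)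
  have "g (z + v + w) - g (z + v) - g (z + w) + g z - v \<bullet> hess g z w
      = v \<bullet> (gradient g (y + w) - gradient g y - hess g z w)"
    using mvt by (simp add: \<phi>_def y_def inner_diff_right)
  also have "\<bar>\<dots>\<bar> \<le> norm v * norm (gradient g (y + w) - gradient g y - hess g z w)"
    by (rule Cauchy_Schwarz_ineq2)
  also have "\<dots> \<le> norm v * (L * norm w * (norm v + norm w))"
    by (intro mult_left_mono *) simp
  finally show ?thesis by (simp add: mult_ac)
qed

text \<open>Exchanging \<open>v\<close> and \<open>w\<close> in the second difference bounds the antisymmetric part of the Hessian
  form by a term of degree three in \<open>(v, w)\<close>. The antisymmetric part is itself of degree two,
  so scaling both vectors by a small \<open>t\<close> makes it vanish.\<close>
lemma hess_symmetric:
  fixes g :: "'a::euclidean_space \<Rightarrow> real"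
  assumes g: "twice_differentiable g" and L: "lipschitz_hessian L g"
  shows "v \<bullet> hess g z w = w \<bullet> hess g z v"
proof -
  define K where "K = 2 * (L * norm v * norm w * (norm v + norm w))"
  define e where "e = \<bar>v \<bullet> hess g z w - w \<bullet> hess g z v\<bar>"
  note lin = bounded_linear.linear[OF bounded_linear_hess[OF g]]
  have bound: "e \<le> t * K" if t: "t > 0" for t
  proof -
    have scale: "L * norm (t *\<^sub>R a) * norm (t *\<^sub>R b) * (norm (t *\<^sub>R a) + norm (t *\<^sub>R b))
        = t^3 * (L * norm a * norm b * (norm a + norm b))" for a b :: 'a
      using t by (simp add: power3_eq_cube algebra_simps)
    have "\<bar>(t *\<^sub>R v) \<bullet> hess g z (t *\<^sub>R w) - (t *\<^sub>R w) \<bullet> hess g z (t *\<^sub>R v)\<bar>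
       \<le> t^3 * (L * norm v * norm w * (norm v + norm w)) + t^3 * (L * norm w * norm v * (norm w + norm v))"
      using second_difference_hess[OF g L, of z "t *\<^sub>R v" "t *\<^sub>R w", unfolded scale]
            second_difference_hess[OF g L, of z "t *\<^sub>R w" "t *\<^sub>R v", unfolded scale
              add.assoc[of z] add.commute[of "t *\<^sub>R w" "t *\<^sub>R v"]]
      unfolding add.assoc[of z] by linarith
    also have "\<dots> = t^2 * (t * K)" by (simp add: K_def power2_eq_square power3_eq_cube algebra_simps)
    also have "(t *\<^sub>R v) \<bullet> hess g z (t *\<^sub>R w) - (t *\<^sub>R w) \<bullet> hess g z (t *\<^sub>R v)
       = t^2 * (v \<bullet> hess g z w - w \<bullet> hess g z v)"
      by (simp add: linear_cmul[OF lin] power2_eq_square algebra_simps)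
    finally show ?thesis using t by (simp add: e_def abs_mult)
  qed
  have "((\<lambda>t. t * K) \<longlongrightarrow> 0 * K) (at_right 0)" by (intro tendsto_intros)
  then have "e \<le> 0 * K"
    by (rule tendsto_lowerbound) (auto simp: eventually_at_right_less intro!: eventually_mono[OF eventually_at_right_less[of 0]] bound)
  then show ?thesis by (simp add: e_def)
qed

text \<open>The lower left block is \<^const>\<open>Dyx\<close>, by definition the transpose of \<^const>\<open>Dxy\<close>, only
  because the Hessian is symmetric.\<close>
lemma hess_blocks:
  fixes f :: "(real^'m) \<times> (real^'n) \<Rightarrow> real"
  assumes f: "twice_differentiable f" and L: "lipschitz_hessian L f"
  shows "hess f z (p, q) = (Dxx f z *v p + Dxy f z *v q, Dyx f z *v p + Dyy f z *v q)"
proof -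
  note bl = bounded_linear_hess[OF f, of z]
  have blx: "bounded_linear (\<lambda>p. hess f z (p, 0))"
    by (rule bounded_linear_compose[OF bl]) (intro bounded_linear_Pair bounded_linear_ident bounded_linear_zero)
  have bly: "bounded_linear (\<lambda>q. hess f z (0, q))"
    by (rule bounded_linear_compose[OF bl]) (intro bounded_linear_Pair bounded_linear_ident bounded_linear_zero)
  have lin: "linear (\<lambda>p. fst (hess f z (p, 0)))" "linear (\<lambda>p. snd (hess f z (p, 0)))"
     "linear (\<lambda>q. fst (hess f z (0, q)))" "linear (\<lambda>q. snd (hess f z (0, q)))"
    by (intro bounded_linear.linear bounded_linear_fst_comp bounded_linear_snd_comp blx bly)+
  have ix: "(axis i 1, 0) \<bullet> s = fst s $ i" for i and s :: "(real^'m) \<times> (real^'n)"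
    by (simp add: inner_prod_def inner_axis')
  have iy: "(0, axis i 1) \<bullet> s = snd s $ i" for i and s :: "(real^'m) \<times> (real^'n)"
    by (simp add: inner_prod_def inner_axis')
  have "Dxx f z = matrix (\<lambda>p. fst (hess f z (p, 0)))" "Dxy f z = matrix (\<lambda>q. fst (hess f z (0, q)))"
    "Dyy f z = matrix (\<lambda>q. snd (hess f z (0, q)))"
    by (simp_all add: Dxx_def Dxy_def Dyy_def matrix_def ix iy)
  moreover have "Dyx f z = matrix (\<lambda>p. snd (hess f z (p, 0)))"
    unfolding Dyx_def Dxy_def transpose_def matrix_def
    by (subst hess_symmetric[OF f L]) (simp add: iy)
  moreover have "hess f z (p, q) = hess f z (p, 0) + hess f z (0, q)"
    using linear_add[OF bounded_linear.linear[OF bl], of "(p,0)" "(0,q)"] by simp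
  ultimately show ?thesis
    using lin by (simp add: matrix_vector_mul(1) prod_eq_iff)
qed

lemma symmetric_Dxx:
  assumes f: "twice_differentiable f" and L: "lipschitz_hessian L f"
  shows "transpose (Dxx f z) = Dxx f z"
  unfolding Dxx_def transpose_def vec_eq_iff
  by (auto intro: hess_symmetric[OF f L])

lemma symmetric_Dyy:
  assumes f: "twice_differentiable f" and L: "lipschitz_hessian L f"
  shows "transpose (Dyy f z) = Dyy f z"
  unfolding Dyy_def transpose_def vec_eq_iff
  by (auto intro: hess_symmetric[OF f L])

section \<open>The spectral theorem for real symmetric matrices\<close>

text \<open>A maximiser of the Rayleigh quotient on the unit sphere of an invariant subspace is an
  eigenvector: the residual \<open>r = T x - l x\<close> is orthogonal to \<open>x\<close>, and moving from \<open>x\<close> in the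
  direction \<open>r\<close> would increase the quotient at first order, with slope \<open>2 (r \<bullet> r)\<close>, unless \<open>r = 0\<close>.\<close>
lemma self_adjoint_eigenvector:
  fixes T :: "'a::euclidean_space \<Rightarrow> 'a"
  assumes T: "linear T" and sa: "\<And>x y. T x \<bullet> y = x \<bullet> T y"
    and S: "subspace S" "S \<noteq> {0}" and inv: "\<And>x. x \<in> S \<Longrightarrow> T x \<in> S"
  obtains l x where "x \<in> S" "norm x = 1" "T x = l *\<^sub>R x"
proof -
  define U where "U = S \<inter> sphere 0 1"
  have "compact U"
    unfolding U_def by (intro closed_Int_compact closed_subspace S compact_sphere)
  moreover have "U \<noteq> {}"
  proof -
    obtain y where "y \<in> S" "y \<noteq> 0" using S subspace_0 by blast
    then have "y /\<^sub>R norm y \<in> U" using S by (simp add: U_def subspace_scale)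
    then show ?thesis by blast
  qed
  moreover have "continuous_on U (\<lambda>x. x \<bullet> T x)"
    by (intro continuous_intros linear_continuous_on) (simp add: T linear_conv_bounded_linear[symmetric])
  ultimately obtain x where x: "x \<in> U" and max: "\<And>y. y \<in> U \<Longrightarrow> y \<bullet> T y \<le> x \<bullet> T x"
    using continuous_attains_sup[of U "\<lambda>x. x \<bullet> T x"] by auto
  define l where "l = x \<bullet> T x"
  have x1: "x \<in> S" "norm x = 1" "x \<bullet> x = 1"
    using x by (auto simp: U_def norm_eq_1)
  have Rayleigh: "y \<bullet> T y \<le> l * (y \<bullet> y)" if y: "y \<in> S" for y
  proof (cases "y = 0")
    case True then show ?thesis by simp
  next
    case False
    then have "y /\<^sub>R norm y \<in> U" using S y by (simp add: U_def subspace_scale)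
    from max[OF this] show ?thesis
      using False by (simp add: l_def linear_cmul[OF T] field_simps dot_square_norm power2_eq_square)
  qed
  define r where "r = T x - l *\<^sub>R x"
  have r: "r \<in> S" using S x1 inv by (simp add: r_def subspace_diff subspace_scale)
  have xr: "x \<bullet> r = 0" by (simp add: r_def inner_diff_right x1 l_def)
  define c where "c = r \<bullet> T r - l * (r \<bullet> r)"
  have quad: "2 * t * (r \<bullet> r) + t\<^sup>2 * c \<le> 0" for t
  proof -
    have "x + t *\<^sub>R r \<in> S" using S x1 r by (simp add: subspace_add subspace_scale)
    from Rayleigh[OF this]
    have "(x \<bullet> T x) + 2 * t * (r \<bullet> T x) + t\<^sup>2 * (r \<bullet> T r) \<le> l * (1 + t\<^sup>2 * (r \<bullet> r))"
      by (simp add: linear_add[OF T] linear_cmul[OF T] inner_add_left inner_add_right x1 xr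
          inner_commute[of r x] sa[of x r, symmetric] inner_commute[of "T x" r] power2_eq_square algebra_simps)
    moreover have "r \<bullet> T x = r \<bullet> r"
      using xr by (simp add: r_def inner_diff_right inner_commute)
    ultimately show ?thesis by (simp add: c_def l_def algebra_simps)
  qed
  have "r \<bullet> r = 0"
  proof (rule ccontr)
    assume nz: "r \<bullet> r \<noteq> 0"
    define R where "R = r \<bullet> r"
    \<comment> \<open>a step so short that the second order term \<open>t * c\<close> cannot outweigh \<open>2 * R\<close>\<close>
    define t where "t = R / (1 + \<bar>c\<bar>)"
    have R: "R > 0" using nz by (simp add: R_def)
    then have t: "t > 0" by (simp add: t_def)
    have "2 * R + t * c \<le> 0"
    proof -
      have "t * (2 * R + t * c) \<le> 0" using quad[of t] by (simp add: R_def power2_eq_square algebra_simps)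
      then show ?thesis using t by (simp add: mult_le_0_iff)
    qed
    moreover have "t * \<bar>c\<bar> \<le> R" using R by (simp add: t_def field_simps)
    moreover have "- (t * \<bar>c\<bar>) \<le> t * c" using t by (simp add: abs_if)
    ultimately show False using R by linarith
  qed
  then have "T x = l *\<^sub>R x" by (simp add: r_def)
  with x1 that show thesis by blast
qed

text \<open>Split off one eigenvector; self-adjointness makes its orthogonal complement invariant again.
  The statement is about invariant subspaces so that the induction on the dimension can pass to
  that complement.\<close>
lemma self_adjoint_eigenbasis:
  fixes T :: "'a::euclidean_space \<Rightarrow> 'a"
  assumes T: "linear T" and sa: "\<And>x y. T x \<bullet> y = x \<bullet> T y"
    and S: "subspace S" and inv: "\<And>x. x \<in> S \<Longrightarrow> T x \<in> S"
  shows "\<exists>B. pairwise orthogonal B \<and> (\<forall>b\<in>B. norm b = 1 \<and> (\<exists>l. T b = l *\<^sub>R b)) \<and> span B = S"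
  using S inv
proof (induction "dim S" arbitrary: S rule: less_induct)
  case less
  show ?case
  proof (cases "S = {0}")
    case True
    then show ?thesis by (intro exI[of _ "{}"]) auto
  next
    case False
    obtain l x where x: "x \<in> S" "norm x = 1" "T x = l *\<^sub>R x"
      using self_adjoint_eigenvector[OF T sa less.prems(1) False less.prems(2)] by metis
    define S' where "S' = S \<inter> {y. x \<bullet> y = 0}"
    have S': "subspace S'"
      unfolding S'_def by (intro subspace_inter less.prems subspace_hyperplane)
    have inv': "T y \<in> S'" if "y \<in> S'" for y
      using that less.prems(2) sa[of x y] by (simp add: S'_def x)
    have "x \<notin> S'" using x by (auto simp: S'_def dot_square_norm)
    then have "S' \<subset> S" using x unfolding S'_def by blast
    moreover have "span S' = S'" "span S = S" using S' less.prems(1) by (simp_all add: span_eq_iff)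
    ultimately have "span S' \<subset> span S" by (simp only:)
    then have "dim S' < dim S" by (rule dim_psubset)
    from less.hyps[OF this S' inv'] obtain B
      where B: "pairwise orthogonal B" "\<forall>b\<in>B. norm b = 1 \<and> (\<exists>l. T b = l *\<^sub>R b)" "span B = S'"
      by blast
    have BS': "B \<subseteq> S'" using B(3) span_superset by blast
    have "span (insert x B) = S"
    proof
      show "span (insert x B) \<subseteq> S"
        using BS' x by (intro span_minimal less.prems) (auto simp: S'_def)
      show "S \<subseteq> span (insert x B)"
      proof
        fix y assume y: "y \<in> S"
        have "y - (x \<bullet> y) *\<^sub>R x \<in> span B"
          using y x less.prems(1) unfolding B(3) S'_def
          by (auto simp: subspace_diff subspace_scale inner_diff_right dot_square_norm)
        then show "y \<in> span (insert x B)" by (auto simp: span_insert)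
      qed
    qed
    moreover have "pairwise orthogonal (insert x B)"
      using B(1) BS' by (auto simp: pairwise_insert orthogonal_def S'_def inner_commute)
    ultimately show ?thesis using B(2) x by (intro exI[of _ "insert x B"]) auto
  qed
qed

lemma symmetric_inner_matrix:
  fixes A :: "real^'n^'n"
  assumes "transpose A = A"
  shows "(A *v x) \<bullet> y = x \<bullet> (A *v y)"
  by (metis assms dot_lmul_matrix transpose_matrix_vector)

lemma symmetric_matrix_diagonalizable:
  fixes A :: "real^'n^'n"
  assumes A: "transpose A = A"
  obtains Q d where "orthogonal_matrix Q"
    "A = Q ** (\<chi> i j. if i = j then d i else 0) ** transpose Q"
proof -
  have "\<exists>B. pairwise orthogonal B \<and> (\<forall>b\<in>B. norm b = 1 \<and> (\<exists>l. A *v b = l *\<^sub>R b)) \<and> span B = UNIV"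
    by (rule self_adjoint_eigenbasis) (auto simp: symmetric_inner_matrix[OF A])
  then obtain B where B: "pairwise orthogonal B" "\<And>b. b \<in> B \<Longrightarrow> norm b = 1"
      "\<And>b. b \<in> B \<Longrightarrow> \<exists>l. A *v b = l *\<^sub>R b" "span B = UNIV"
    by blast
  have "independent B"
    using B(1,2) by (intro pairwise_orthogonal_independent) fastforce+
  then have "card B = dim (UNIV :: (real^'n) set)"
    using B(4) dim_eq_card[of B UNIV] by simp
  then have "card B = CARD('n)" by simp
  moreover have "finite B" using \<open>independent B\<close> by (rule independent_imp_finite)
  ultimately obtain q where q: "bij_betw q (UNIV :: 'n set) B"
    using finite_same_card_bij[of "UNIV :: 'n set" B] by auto
  then have qB: "q i \<in> B" for i by (auto simp: bij_betw_def)
  obtain d where d: "\<And>i. A *v q i = d i *\<^sub>R q i"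
    using B(3)[OF qB] by metis
  define Q :: "real^'n^'n" where "Q = (\<chi> i j. q j $ i)"
  have col: "column j Q = q j" for j by (simp add: column_def Q_def vec_eq_iff)
  have Q: "orthogonal_matrix Q"
    unfolding orthogonal_matrix_orthonormal_columns col
    using B(1,2) qB bij_betw_imp_inj_on[OF q] unfolding pairwise_def by (metis injD)
  define E :: "real^'n^'n" where "E = (\<chi> i j. if i = j then d i else 0)"
  have "A ** Q = Q ** E"
  proof -
    have "(A ** Q) $ i $ j = (Q ** E) $ i $ j" for i j
    proof -
      have "(A ** Q) $ i $ j = (A *v q j) $ i"
        by (simp add: matrix_matrix_mult_def matrix_vector_mult_def Q_def)
      also have "\<dots> = (Q ** E) $ i $ j"
        by (simp add: d matrix_matrix_mult_def Q_def E_def if_distrib cong: if_cong)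
      finally show ?thesis .
    qed
    then show ?thesis by (simp add: vec_eq_iff)
  qed
  then have "A ** Q ** transpose Q = Q ** E ** transpose Q" by simp
  then have "A = Q ** E ** transpose Q"
    using Q by (simp add: orthogonal_matrix_def flip: matrix_mul_assoc)
  with Q that show thesis unfolding E_def by blast
qed

text \<open>The spectral theorem as a change of coordinates: an isometry \<open>U\<close> in which \<open>A\<close> and every
  spectral function of \<open>A\<close> act as multiplication operators with the same eigenvalues. Inequalities
  between quadratic forms in \<open>A\<close> and \<open>spectral_fun h A\<close> thereby become scalar inequalities, one
  for each eigenvalue.\<close>
lemma spectral_coordinates:
  fixes A :: "real^'n^'n"
  assumes A: "transpose A = A"
  obtains U :: "real^'n \<Rightarrow> real^'n" and d where "linear U"
    "\<And>x y. x \<bullet> y = (\<Sum>i\<in>UNIV. U x $ i * U y $ i)"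
    "\<And>x i. U (A *v x) $ i = d i * U x $ i"
    "\<And>h x i. U (spectral_fun h A *v x) $ i = h (d i) * U x $ i"
    "\<And>i. \<bar>d i\<bar> \<le> spectral_norm A"
proof -
  obtain Q d where Q: "orthogonal_matrix Q"
    and AQ: "A = Q ** (\<chi> i j. if i = j then d i else 0) ** transpose Q"
    using symmetric_matrix_diagonalizable[OF A] by blast
  define U where "U x = transpose Q *v x" for x
  have lin: "linear U" unfolding U_def[abs_def] by (rule matrix_vector_mul_linear)
  have orth: "orthogonal_transformation U"
    using Q unfolding U_def[abs_def] orthogonal_transformation_matrix
    by (simp add: orthogonal_matrix_transpose del: transpose_matrix_vector)
  have diag: "U ((Q ** (\<chi> i j. if i = j then e i else 0) ** transpose Q) *v x) $ i = e i * U x $ i" for e x i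
  proof -
    have "transpose Q *v (Q *v y) = y" for y
      using Q by (simp add: matrix_vector_mul_assoc orthogonal_matrix_def del: transpose_matrix_vector)
    moreover have "((\<chi> i j. if i = j then e i else 0) *v w) $ i = e i * w $ i" for w
      by (simp add: matrix_vector_mult_def if_distrib[where f = "\<lambda>t. t * _"] cong: if_cong)
    ultimately show ?thesis
      by (simp add: U_def del: transpose_matrix_vector flip: matrix_vector_mul_assoc)
  qed
  have dA: "U (A *v x) $ i = d i * U x $ i" for x i
    using diag[of d x i] by (simp flip: AQ)
  have dh: "U (spectral_fun h A *v x) $ i = h (d i) * U x $ i" for h x i
    unfolding spectral_fun_diagonalized[OF Q AQ] by (rule diag)
  have bound: "\<bar>d i\<bar> \<le> spectral_norm A" for i
  proof -
    obtain x where x: "U x = axis i 1"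
      using orthogonal_transformation_surj[OF orth] by (metis surjD)
    have isometry: "norm (U y) = norm y" for y
      using orth by (simp add: orthogonal_transformation_norm)
    have "norm x = 1" using isometry[of x] by (simp add: x)
    moreover have "U (A *v x) = d i *\<^sub>R U x"
      by (auto simp: vec_eq_iff dA x axis_def)
    then have "norm (A *v x) = \<bar>d i\<bar> * norm x"
      using isometry[of "A *v x"] isometry[of x] by simp
    ultimately show ?thesis
      using onorm[OF matrix_vector_mul_bounded_linear, of A x] by (simp add: spectral_norm_def)
  qed
  have "x \<bullet> y = (\<Sum>i\<in>UNIV. U x $ i * U y $ i)" for x y
  proof -
    have "x \<bullet> y = U x \<bullet> U y" using orth by (simp add: orthogonal_transformation_def)
    then show ?thesis by (simp add: inner_vec_def)
  qed
  then show thesis by (rule that[OF lin _ dA dh bound])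
qed

section \<open>Contraction by a small symmetric matrix\<close>

text \<open>Write \<open>w = x - u\<close>. Up to second order in \<open>d\<close>, the left side exceeds \<open>x\<^sup>2\<close> by
  \<open>- d (4 u w + 2 w\<^sup>2) - \<bar>d\<bar> u\<^sup>2\<close>. The last summand, which is why \<^const>\<open>h_pm\<close> subtracts \<open>\<bar>d\<bar>\<close>,
  absorbs the part of the cross term and of \<open>d\<^sup>2 x\<^sup>2\<close> that is quadratic in \<open>u\<close>; a small multiple
  of \<open>w\<^sup>2\<close> remains.\<close>
lemma scalar_contraction:
  fixes d x u :: real
  assumes "\<bar>d\<bar> \<le> 1 / 18"
  shows "(x - d * x)\<^sup>2 + 2 * h_pm d * u\<^sup>2 \<le> x\<^sup>2 + 2 / 5 * (x - u)\<^sup>2"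
proof -
  define w e where "w = x - u" and "e = \<bar>d\<bar>"
  have x: "x = u + w" by (simp add: w_def)
  have e: "0 \<le> e" "e \<le> 1 / 18" using assms by (auto simp: e_def)
  have dd: "d\<^sup>2 * x\<^sup>2 \<le> e * ((u\<^sup>2 + w\<^sup>2) / 9)"
  proof -
    have "d\<^sup>2 = e * e" by (simp add: e_def power2_eq_square flip: abs_mult)
    moreover have "x\<^sup>2 \<le> 2 * (u\<^sup>2 + w\<^sup>2)"
      using sum_squares_ge_zero[of "u - w" 0] by (simp add: x power2_eq_square algebra_simps)
    then have "e * x\<^sup>2 \<le> 1 / 18 * (2 * (u\<^sup>2 + w\<^sup>2))" using e by (intro mult_mono) auto
    then have "e * x\<^sup>2 \<le> (u\<^sup>2 + w\<^sup>2) / 9" by simp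
    then have "e * (e * x\<^sup>2) \<le> e * ((u\<^sup>2 + w\<^sup>2) / 9)" using e by (intro mult_left_mono)
    ultimately show ?thesis by (simp only: mult.assoc)
  qed
  have "(x - d * x)\<^sup>2 + 2 * h_pm d * u\<^sup>2 - x\<^sup>2 = d\<^sup>2 * x\<^sup>2 - d * (4 * u * w + 2 * w\<^sup>2) - e * u\<^sup>2"
    by (simp add: h_pm_def phi_def e_def x power2_eq_square field_simps)
  also have "\<dots> \<le> e * ((u\<^sup>2 + w\<^sup>2) / 9) + e * (8/9 * u\<^sup>2 + 9/2 * w\<^sup>2 + 2 * w\<^sup>2) - e * u\<^sup>2"
  proof -
    \<comment> \<open>Young's inequality; the weight \<open>8/9\<close> of \<open>u\<^sup>2\<close> is what \<open>\<bar>d\<bar> u\<^sup>2\<close> can still absorb after the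
      share \<open>1/9\<close> taken by \<open>d\<^sup>2 x\<^sup>2\<close>\<close>
    have uw: "\<bar>4 * u * w\<bar> \<le> 8/9 * u\<^sup>2 + 9/2 * w\<^sup>2"
      using zero_le_power2[of "4/3 * u - 3 * w"] zero_le_power2[of "4/3 * u + 3 * w"]
      by (simp add: power2_eq_square algebra_simps abs_le_iff)
    have "\<bar>4 * u * w + 2 * w\<^sup>2\<bar> \<le> 8/9 * u\<^sup>2 + 9/2 * w\<^sup>2 + 2 * w\<^sup>2"
      using uw zero_le_power2[of w] by linarith
    then have "e * \<bar>4 * u * w + 2 * w\<^sup>2\<bar> \<le> e * (8/9 * u\<^sup>2 + 9/2 * w\<^sup>2 + 2 * w\<^sup>2)"
      using e by (intro mult_left_mono)
    moreover have "- (d * (4 * u * w + 2 * w\<^sup>2)) \<le> e * \<bar>4 * u * w + 2 * w\<^sup>2\<bar>"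
      unfolding e_def abs_mult[symmetric] by simp
    ultimately show ?thesis using dd by linarith
  qed
  also have "\<dots> = e * (119/18 * w\<^sup>2)" by (simp add: algebra_simps)
  also have "\<dots> \<le> 1/18 * (119/18 * w\<^sup>2)" using e by (intro mult_right_mono) auto
  also have "\<dots> \<le> 2/5 * (x - u)\<^sup>2" by (simp add: w_def)
  finally show ?thesis by simp
qed

text \<open>In the application \<open>u\<close> is a partial gradient, \<open>x\<close> is, up to sign, the direction in which the
  method moves, and \<open>x - u\<close> is the contribution of the interaction of the two players.\<close>
lemma symmetric_contraction:
  fixes A :: "real^'n^'n"
  assumes A: "transpose A = A" and eta: "\<eta> \<ge> 0" and small: "\<eta> * spectral_norm A \<le> 1 / 18"
  shows "(norm (x - \<eta> *\<^sub>R (A *v x)))\<^sup>2 + u \<bullet> ((2 * \<eta>) *\<^sub>R (spectral_fun h_pm A *v u))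
           \<le> (norm x)\<^sup>2 + 2 / 5 * (norm (x - u))\<^sup>2"
proof (rule spectral_coordinates[OF A])
  fix U d
  assume U: "linear U"
    and ip: "\<And>x y. x \<bullet> y = (\<Sum>i\<in>UNIV. U x $ i * U y $ i)"
    and UA: "\<And>x i. U (A *v x) $ i = d i * U x $ i"
    and Uh: "\<And>h x i. U (spectral_fun h A *v x) $ i = h (d i) * U x $ i"
    and d: "\<And>i. \<bar>d i\<bar> \<le> spectral_norm A"
  have nrm: "(norm v)\<^sup>2 = (\<Sum>i\<in>UNIV. (U v $ i)\<^sup>2)" for v
    unfolding power2_norm_eq_inner ip by (simp add: power2_eq_square)
  have "(norm (x - \<eta> *\<^sub>R (A *v x)))\<^sup>2 + u \<bullet> ((2 * \<eta>) *\<^sub>R (spectral_fun h_pm A *v u))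
     = (\<Sum>i\<in>UNIV. (U x $ i - (\<eta> * d i) * U x $ i)\<^sup>2 + 2 * h_pm (\<eta> * d i) * (U u $ i)\<^sup>2)"
  proof -
    have "h_pm (\<eta> * d i) = \<eta> * h_pm (d i)" for i
      using eta by (simp add: h_pm_def phi_def abs_mult algebra_simps)
    then have "(U (x - \<eta> *\<^sub>R (A *v x)) $ i)\<^sup>2 + U u $ i * U ((2 * \<eta>) *\<^sub>R (spectral_fun h_pm A *v u)) $ i
        = (U x $ i - (\<eta> * d i) * U x $ i)\<^sup>2 + 2 * h_pm (\<eta> * d i) * (U u $ i)\<^sup>2" for i
      by (simp add: linear_diff[OF U] linear_cmul[OF U] UA Uh power2_eq_square mult_ac)
    then show ?thesis by (simp only: nrm ip sum.distrib[symmetric])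
  qed
  also have "\<dots> \<le> (\<Sum>i\<in>UNIV. (U x $ i)\<^sup>2 + 2 / 5 * (U x $ i - U u $ i)\<^sup>2)"
  proof (intro sum_mono scalar_contraction)
    fix i
    have "\<bar>\<eta> * d i\<bar> \<le> \<eta> * spectral_norm A"
      using eta d[of i] by (simp add: abs_mult mult_left_mono)
    then show "\<bar>\<eta> * d i\<bar> \<le> 1 / 18" using small by linarith
  qed
  also have "\<dots> = (norm x)\<^sup>2 + 2 / 5 * (norm (x - u))\<^sup>2"
    by (simp add: nrm linear_diff[OF U] sum.distrib sum_distrib_left)
  finally show ?thesis .
qed

section \<open>The direction of competitive gradient descent\<close>

lemma invertible_one_plus_gram:
  fixes N :: "real^'n^'m"
  defines "G \<equiv> mat 1 + N ** transpose N"
  shows "matrix_inv G ** G = mat 1" "G ** matrix_inv G = mat 1"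
proof -
  have "x = 0" if "G *v x = 0" for x
  proof -
    have "0 = x \<bullet> (G *v x)" using that by simp
    also have "\<dots> = x \<bullet> x + x \<bullet> (N *v (transpose N *v x))"
      by (simp add: G_def matrix_vector_mult_add_rdistrib matrix_vector_mul_assoc inner_add_right
          del: transpose_matrix_vector)
    also have "x \<bullet> (N *v (transpose N *v x)) = (transpose N *v x) \<bullet> (transpose N *v x)"
      by (simp add: dot_lmul_matrix)
    finally show "x = 0"
      by (metis add_nonneg_eq_0_iff inner_eq_zero_iff inner_ge_zero)
  qed
  then have "invertible G"
    unfolding invertible_left_inverse matrix_left_invertible_ker by blast
  then show "matrix_inv G ** G = mat 1" "G ** matrix_inv G = mat 1"
    unfolding matrix_inv_def invertible_def by (metis (mono_tags, lifting) someI_ex)+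
qed

text \<open>The update direction \<open>(a, b)\<close> is the Nash equilibrium of the local bilinear game with
  quadratic penalties \<open>|a|\<^sup>2 / 2\<close> and \<open>|b|\<^sup>2 / 2\<close> on the moves: each player follows the own
  gradient, corrected by the anticipated move of the opponent. The equilibrium conditions are the
  two linear equations; they are what makes the analysis tractable, as they say that the bilinear
  part of the game turns the gradient \<open>(u, v)\<close> into \<open>(- a, b)\<close>.
  The proof rests on \<open>P N = N P'\<close>, which follows from \<open>N (1 + N\<^sup>T N) = (1 + N N\<^sup>T) N\<close>.\<close>
lemma cgd_direction:
  fixes N :: "real^'n^'m" and u :: "real^'m" and v :: "real^'n"
  defines "P \<equiv> matrix_inv (mat 1 + N ** transpose N)"
    and "P' \<equiv> matrix_inv (mat 1 + transpose N ** N)"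
  defines "a \<equiv> - (P *v (u + N *v v))" and "b \<equiv> - (P' *v (- v + transpose N *v u))"
  shows "a + N *v b = - u" "b - transpose N *v a = v"
    and "(norm a)\<^sup>2 + (norm b)\<^sup>2 = u \<bullet> (P *v u) + v \<bullet> (P' *v v)"
proof -
  note [simp del] = transpose_matrix_vector
  note inv = invertible_one_plus_gram[of N]
  note inv' = invertible_one_plus_gram[of "transpose N", simplified]
  define p q where "p = P *v u" and "q = P' *v v"
  have u: "u = p + N *v (transpose N *v p)"
  proof -
    have "u = ((mat 1 + N ** transpose N) ** P) *v u" by (simp add: P_def inv)
    then show ?thesis
      by (simp add: p_def matrix_vector_mult_add_rdistrib flip: matrix_vector_mul_assoc)
  qed
  have v: "v = q + transpose N *v (N *v q)"
  proof -
    have "v = ((mat 1 + transpose N ** N) ** P') *v v" by (simp add: P'_def inv')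
    then show ?thesis
      by (simp add: q_def matrix_vector_mult_add_rdistrib flip: matrix_vector_mul_assoc)
  qed
  have P: "P *v (x + N *v (transpose N *v x)) = x" for x
  proof -
    have "x = (P ** (mat 1 + N ** transpose N)) *v x" by (simp add: P_def inv)
    then show ?thesis
      by (simp add: matrix_vector_mult_add_rdistrib flip: matrix_vector_mul_assoc)
  qed
  have P': "P' *v (x + transpose N *v (N *v x)) = x" for x
  proof -
    have "x = (P' ** (mat 1 + transpose N ** N)) *v x" by (simp add: P'_def inv')
    then show ?thesis
      by (simp add: matrix_vector_mult_add_rdistrib flip: matrix_vector_mul_assoc)
  qed
  have a: "a = - p - N *v q"
  proof -
    have "N *v v = N *v q + N *v (transpose N *v (N *v q))"
      by (subst v) (simp add: matrix_vector_right_distrib)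
    then have "P *v (N *v v) = N *v q" by (simp only: P)
    then show ?thesis by (simp add: a_def p_def matrix_vector_right_distrib)
  qed
  have b: "b = q - transpose N *v p"
  proof -
    have "transpose N *v u = transpose N *v p + transpose N *v (N *v (transpose N *v p))"
      by (subst u) (simp add: matrix_vector_right_distrib)
    then have "P' *v (transpose N *v u) = transpose N *v p" by (simp only: P')
    then show ?thesis
      by (simp add: b_def q_def matrix_vector_right_distrib matrix_vector_mult_diff_distrib)
  qed
  show "a + N *v b = - u" "b - transpose N *v a = v"
    by (subst u v, simp add: a b matrix_vector_right_distrib matrix_vector_mult_diff_distrib
         linear_neg[OF matrix_vector_mul_linear])+
  have adj: "(N *v y) \<bullet> x = y \<bullet> (transpose N *v x)" for x y
    by (metis dot_lmul_matrix inner_commute transpose_matrix_vector)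
  have "(norm a)\<^sup>2 + (norm b)\<^sup>2
      = p \<bullet> p + (transpose N *v p) \<bullet> (transpose N *v p) + (q \<bullet> q + (N *v q) \<bullet> (N *v q))"
    unfolding power2_norm_eq_inner a b
    by (simp add: inner_diff_left inner_diff_right inner_commute[of p "N *v q"] inner_commute[of "transpose N *v p" q] adj)
  also have "\<dots> = u \<bullet> p + v \<bullet> q"
  proof -
    have "u \<bullet> p = p \<bullet> p + (transpose N *v p) \<bullet> (transpose N *v p)"
      by (subst u) (simp add: inner_add_left adj)
    moreover have "v \<bullet> q = q \<bullet> q + (N *v q) \<bullet> (N *v q)"
      by (subst v) (simp add: inner_add_left inner_add_right adj inner_commute)
    ultimately show ?thesis by simp
  qed
  finally show "(norm a)\<^sup>2 + (norm b)\<^sup>2 = u \<bullet> (P *v u) + v \<bullet> (P' *v v)"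
    by (simp add: p_def q_def)
qed

text \<open>In \<open>u = - (a + N b)\<close> and \<open>v = b - N\<^sup>T a\<close> the cross terms of the two squares cancel. This
  cancellation reflects the zero-sum structure, in which the interaction enters with opposite signs.\<close>
lemma cgd_direction_energy:
  fixes N :: "real^'n^'m"
  assumes a: "a + N *v b = - u" and b: "b - transpose N *v a = v"
  shows "(norm u)\<^sup>2 + (norm v)\<^sup>2
           = (norm a)\<^sup>2 + (norm b)\<^sup>2 + ((norm (N *v b))\<^sup>2 + (norm (transpose N *v a))\<^sup>2)"
proof -
  have adj: "(N *v b) \<bullet> a = b \<bullet> (transpose N *v a)"
    by (metis dot_lmul_matrix inner_commute transpose_matrix_vector)
  have "(norm u)\<^sup>2 = (norm (a + N *v b))\<^sup>2" by (simp add: a)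
  moreover have "(norm v)\<^sup>2 = (norm (b - transpose N *v a))\<^sup>2" by (simp only: b)
  ultimately show ?thesis
    by (simp add: power2_norm_eq_inner inner_add_left inner_add_right inner_diff_left inner_diff_right
        inner_commute[of a "N *v b"] inner_commute[of "transpose N *v a" b] adj
        del: transpose_matrix_vector)
qed

lemma resolvent_complement:
  fixes N :: "real^'n^'m"
  defines "P \<equiv> matrix_inv (mat 1 + N ** transpose N)"
  shows "(P ** (N ** transpose N)) *v x = x - P *v x"
proof -
  have "x = (P ** (mat 1 + N ** transpose N)) *v x"
    by (simp add: P_def invertible_one_plus_gram)
  also have "\<dots> = P *v x + (P ** (N ** transpose N)) *v x"
    by (simp add: matrix_add_ldistrib matrix_vector_mult_add_rdistrib)
  finally show ?thesis by (simp add: algebra_simps)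
qed

section \<open>Decrease of the gradient norm in one step\<close>

text \<open>Replacing the gradient by its linearisation turns \<open>(u, v)\<close> into
  \<open>(- (a - \<eta> A a), b - \<eta> B b)\<close> with \<open>A = Dxx\<close> and \<open>B = - Dyy\<close>. Both components are bounded by
  \<open>symmetric_contraction\<close>, with \<open>x - u\<close> equal to \<open>N b\<close> and to \<open>N\<^sup>T a\<close>. The price is \<open>2 / 5\<close> of the
  interaction energy \<open>S = |N b|\<^sup>2 + |N\<^sup>T a|\<^sup>2\<close>. Passing from \<open>(u, v)\<close> to \<open>(a, b)\<close> gains the whole of
  \<open>S\<close>, which is exactly the sum of the two quadratic forms of \<open>N N\<^sup>T / (1 + N N\<^sup>T)\<close> and
  \<open>N\<^sup>T N / (1 + N\<^sup>T N)\<close>; so at least a third of these forms remains as a decrease.\<close>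
lemma linearised_step_decrease:
  fixes N :: "real^'n^'m" and A :: "real^'m^'m" and B :: "real^'n^'n"
    and u :: "real^'m" and v :: "real^'n"
  defines "P \<equiv> matrix_inv (mat 1 + N ** transpose N)"
    and "P' \<equiv> matrix_inv (mat 1 + transpose N ** N)"
  defines "a \<equiv> - (P *v (u + N *v v))" and "b \<equiv> - (P' *v (- v + transpose N *v u))"
  assumes A: "transpose A = A" "\<eta> * spectral_norm A \<le> 1 / 18"
    and B: "transpose B = B" "\<eta> * spectral_norm B \<le> 1 / 18"
    and eta: "0 \<le> \<eta>"
  shows "(norm (a - \<eta> *\<^sub>R (A *v a)))\<^sup>2 + (norm (b - \<eta> *\<^sub>R (B *v b)))\<^sup>2
    \<le> (norm u)\<^sup>2 + (norm v)\<^sup>2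
      - u \<bullet> (((2 * \<eta>) *\<^sub>R spectral_fun h_pm A + (1 / 3) *\<^sub>R (P ** (N ** transpose N))) *v u)
      - v \<bullet> (((2 * \<eta>) *\<^sub>R spectral_fun h_pm B + (1 / 3) *\<^sub>R (P' ** (transpose N ** N))) *v v)"
proof -
  note [simp del] = transpose_matrix_vector
  have dir: "a + N *v b = - u" "b - transpose N *v a = v"
    and norms: "(norm a)\<^sup>2 + (norm b)\<^sup>2 = u \<bullet> (P *v u) + v \<bullet> (P' *v v)"
    unfolding a_def b_def P_def P'_def by (rule cgd_direction)+
  define S where "S = (norm (N *v b))\<^sup>2 + (norm (transpose N *v a))\<^sup>2"
  have energy: "(norm u)\<^sup>2 + (norm v)\<^sup>2 = (norm a)\<^sup>2 + (norm b)\<^sup>2 + S"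
    unfolding S_def using dir by (rule cgd_direction_energy)
  have "(P ** (N ** transpose N)) *v u = u - P *v u"
    unfolding P_def by (rule resolvent_complement)
  moreover have "(P' ** (transpose N ** N)) *v v = v - P' *v v"
    unfolding P'_def using resolvent_complement[of "transpose N" v] by simp
  ultimately have S: "S = u \<bullet> ((P ** (N ** transpose N)) *v u) + v \<bullet> ((P' ** (transpose N ** N)) *v v)"
    using energy norms by (simp add: inner_diff_right power2_norm_eq_inner)
  have "(norm (a - \<eta> *\<^sub>R (A *v a)))\<^sup>2 + u \<bullet> ((2 * \<eta>) *\<^sub>R (spectral_fun h_pm A *v u))
      \<le> (norm a)\<^sup>2 + 2 / 5 * (norm (N *v b))\<^sup>2"
  proof -
    have "- a - u = N *v b" using dir(1) by (metis add_diff_cancel_left' minus_diff_commute)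
    moreover have "norm (- a - \<eta> *\<^sub>R (A *v (- a))) = norm (a - \<eta> *\<^sub>R (A *v a))"
      by (simp add: linear_neg[OF matrix_vector_mul_linear] norm_minus_commute)
    ultimately show ?thesis using symmetric_contraction[OF A(1) eta A(2), of "- a" u] by simp
  qed
  moreover have "(norm (b - \<eta> *\<^sub>R (B *v b)))\<^sup>2 + v \<bullet> ((2 * \<eta>) *\<^sub>R (spectral_fun h_pm B *v v))
      \<le> (norm b)\<^sup>2 + 2 / 5 * (norm (transpose N *v a))\<^sup>2"
  proof -
    have "b - v = transpose N *v a" using dir(2) by (simp add: algebra_simps)
    then show ?thesis using symmetric_contraction[OF B(1) eta B(2), of b v] by simp
  qed
  moreover have "S \<ge> 0" by (simp add: S_def)
  ultimately show ?thesis
    using energy S unfolding S_def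
    by (simp add: matrix_vector_mult_add_rdistrib scaleR_matrix_vector_assoc[symmetric] inner_add_right)
qed

lemma scaleR_matrix_mult_scaleR:
  fixes A :: "real^'n^'m" and B :: "real^'k^'n"
  shows "(c *\<^sub>R A) ** (d *\<^sub>R B) = (c * d) *\<^sub>R (A ** B)"
  by (simp add: matrix_matrix_mult_def vec_eq_iff sum_distrib_left mult_ac)

text \<open>The true gradient after a step differs from the linearised one by at most \<open>\<theta> g\<close>, where \<open>g\<close> is the
  norm of the gradient before the step and \<open>\<theta> = \<eta>\<^sup>2 L g\<close>, because the step has length at most \<open>\<eta> g\<close>. Squaring, the error costs at most
  \<open>(2 \<theta> + \<theta>\<^sup>2) g\<^sup>2\<close>, and this is at most \<open>3 \<theta> g\<^sup>2\<close> once \<open>\<theta> \<le> 1\<close>. The latter comes for free: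
  the squared norm of the linearised gradient is at most \<open>(1 - c) g\<^sup>2\<close>, so a nonzero gradient
  forces \<open>c \<le> 1\<close>.\<close>
lemma cgd_step_decrease:
  fixes f :: "(real^'m) \<times> (real^'n) \<Rightarrow> real"
  assumes f: "twice_differentiable f" and L: "lipschitz_hessian L f"
    and eta: "\<eta> > 0" and \<alpha>: "\<alpha> > 0"
    and xx: "\<eta> * spectral_norm (Dxx f z) \<le> 1 / 18"
    and yy: "\<eta> * spectral_norm (Dyy f z) \<le> 1 / 18"
    and c: "\<alpha> + 3 * (\<eta>\<^sup>2 * L * norm (gradient f z)) \<le> c"
    and cx: "(2 * \<eta>) *\<^sub>R spectral_fun h_pm (Dxx f z) + (1 / 3) *\<^sub>R Dbar \<eta> f z \<succeq> mat c"
    and cy: "(2 * \<eta>) *\<^sub>R spectral_fun h_pm (- Dyy f z) + (1 / 3) *\<^sub>R Dtilde \<eta> f z \<succeq> mat c"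
  shows "norm (cgd_step \<eta> f z - z) \<le> \<eta> * norm (gradient f z)"
    and "(norm (gradient f (cgd_step \<eta> f z)))\<^sup>2 \<le> (1 - \<alpha>) * (norm (gradient f z))\<^sup>2"
proof -
  note [simp del] = transpose_matrix_vector
  define u v where "u = fst (gradient f z)" and "v = snd (gradient f z)"
  define N where "N = \<eta> *\<^sub>R Dxy f z"
  define g where "g = norm (gradient f z)"
  have g0: "0 \<le> g" by (simp add: g_def)
  have g2: "g\<^sup>2 = (norm u)\<^sup>2 + (norm v)\<^sup>2"
    by (simp add: g_def u_def v_def norm_prod_def)
  have fd: "f differentiable (at z)" using f unfolding twice_differentiable_def by blast
  have NT: "transpose N = \<eta> *\<^sub>R Dyx f z"
    by (simp add: N_def Dyx_def transpose_def vec_eq_iff)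
  have NN: "\<eta>\<^sup>2 *\<^sub>R (Dxy f z ** Dyx f z) = N ** transpose N"
    and NN': "\<eta>\<^sup>2 *\<^sub>R (Dyx f z ** Dxy f z) = transpose N ** N"
    unfolding NT by (simp_all add: N_def scaleR_matrix_mult_scaleR power2_eq_square)
  define P P' where "P = matrix_inv (mat 1 + N ** transpose N)"
    and "P' = matrix_inv (mat 1 + transpose N ** N)"
  define a b where "a = - (P *v (u + N *v v))" and "b = - (P' *v (- v + transpose N *v u))"
  have step: "cgd_step \<eta> f z = z + \<eta> *\<^sub>R (a, b)"
    unfolding cgd_step_def NN NN' grad_x_eq_fst_gradient[OF fd] grad_y_eq_snd_gradient[OF fd]
    by (simp add: prod_eq_iff a_def b_def P_def P'_def u_def v_def NT[symmetric] N_def[symmetric]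
        scaleR_matrix_vector_assoc)
  have dir: "a + N *v b = - u" "b - transpose N *v a = v"
    unfolding a_def b_def P_def P'_def by (rule cgd_direction)+
  have "(norm a)\<^sup>2 + (norm b)\<^sup>2 \<le> g\<^sup>2"
    using cgd_direction_energy[OF dir] by (simp add: g2)
  then have ab: "norm (a, b) \<le> g"
    using g0 by (simp add: norm_Pair real_le_lsqrt)
  then show "norm (cgd_step \<eta> f z - z) \<le> \<eta> * norm (gradient f z)"
    using eta unfolding step g_def[symmetric] by (simp del: scaleR_Pair)

  define \<theta> where "\<theta> = \<eta>\<^sup>2 * L * g"
  have L0: "0 \<le> L" using f L by (rule lipschitz_hessian_nonneg)
  then have \<theta>0: "0 \<le> \<theta>" using g0 by (simp add: \<theta>_def)

  define lin where "lin = (- (a - \<eta> *\<^sub>R (Dxx f z *v a)), b - \<eta> *\<^sub>R ((- Dyy f z) *v b))"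
  have "gradient f z + hess f z (\<eta> *\<^sub>R (a, b)) = lin"
  proof -
    have "u + N *v b = - a" "v + transpose N *v a = b"
      using dir by (auto simp: algebra_simps eq_neg_iff_add_eq_0)
    moreover have "\<eta> *\<^sub>R (Dxy f z *v b) = N *v b" "\<eta> *\<^sub>R (Dyx f z *v a) = transpose N *v a"
      by (simp_all add: N_def[symmetric] NT[symmetric] scaleR_matrix_vector_assoc)
    moreover have "(- Dyy f z) *v b = - (Dyy f z *v b)"
      using matrix_vector_mult_diff_rdistrib[of 0 "Dyy f z" b] by simp
    ultimately show ?thesis
      by (simp add: lin_def prod_eq_iff u_def[symmetric] v_def[symmetric] hess_blocks[OF f L]
          matrix_vector_mult_scaleR algebra_simps)
  qed
  then have "norm (gradient f (cgd_step \<eta> f z) - lin) \<le> L * (norm (\<eta> *\<^sub>R (a, b)))\<^sup>2"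
    using gradient_taylor[OF f L, of z "\<eta> *\<^sub>R (a, b)"] by (simp add: step algebra_simps)
  also have "\<dots> = L * \<eta>\<^sup>2 * (norm (a, b))\<^sup>2" by (simp add: power_mult_distrib del: scaleR_Pair)
  also have "\<dots> \<le> L * \<eta>\<^sup>2 * g\<^sup>2"
    using ab L0 by (intro mult_left_mono power_mono) auto
  also have "\<dots> = \<theta> * g" by (simp add: \<theta>_def power2_eq_square)
  finally have remainder: "norm (gradient f (cgd_step \<eta> f z) - lin) \<le> \<theta> * g" .

  have lin2: "(norm lin)\<^sup>2 \<le> (1 - c) * g\<^sup>2"
  proof -
    have "spectral_norm (- Dyy f z) = spectral_norm (Dyy f z)"
    proof -
      have "(*v) (- Dyy f z) = (\<lambda>w. - (Dyy f z *v w))"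
        using matrix_vector_mult_diff_rdistrib[of 0 "Dyy f z"] by (simp add: fun_eq_iff)
      then show ?thesis by (simp add: spectral_norm_def onorm_neg)
    qed
    moreover have "transpose (- Dyy f z) = - Dyy f z"
      using symmetric_Dyy[OF f L, of z] by (simp add: transpose_def vec_eq_iff)
    moreover have "(norm lin)\<^sup>2 = (norm (a - \<eta> *\<^sub>R (Dxx f z *v a)))\<^sup>2
        + (norm (b - \<eta> *\<^sub>R ((- Dyy f z) *v b)))\<^sup>2"
      unfolding lin_def norm_Pair norm_minus_cancel by simp
    ultimately have "(norm lin)\<^sup>2 \<le> g\<^sup>2
      - u \<bullet> (((2 * \<eta>) *\<^sub>R spectral_fun h_pm (Dxx f z) + (1 / 3) *\<^sub>R Dbar \<eta> f z) *v u)
      - v \<bullet> (((2 * \<eta>) *\<^sub>R spectral_fun h_pm (- Dyy f z) + (1 / 3) *\<^sub>R Dtilde \<eta> f z) *v v)"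
      using linearised_step_decrease[of "Dxx f z" \<eta> "- Dyy f z" N u v] symmetric_Dxx[OF f L, of z] xx yy eta
      unfolding Dbar_def Dtilde_def NN NN' g2 a_def[symmetric] b_def[symmetric]
        P_def[symmetric] P'_def[symmetric]
      by simp
    also have "\<dots> \<le> g\<^sup>2 - c * (u \<bullet> u) - c * (v \<bullet> v)"
    proof -
      have mat: "mat c *v w = c *\<^sub>R w" for w :: "real^'k"
        by (simp add: vec_eq_iff matrix_vector_mult_def mat_def if_distrib[where f = "\<lambda>t. t * _"] cong: if_cong)
      show ?thesis
        using cx[unfolded loewner_ge_def, rule_format, of u] cy[unfolded loewner_ge_def, rule_format, of v]
        by (simp add: matrix_vector_mult_diff_rdistrib mat inner_diff_right)
    qed
    also have "\<dots> = (1 - c) * g\<^sup>2"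
      by (simp add: g2 power2_norm_eq_inner algebra_simps)
    finally show ?thesis .
  qed

  show "(norm (gradient f (cgd_step \<eta> f z)))\<^sup>2 \<le> (1 - \<alpha>) * (norm (gradient f z))\<^sup>2"
  proof -
    have c': "\<alpha> + 3 * \<theta> \<le> c" using c by (simp add: \<theta>_def g_def)
    have "norm (gradient f (cgd_step \<eta> f z)) \<le> norm lin + \<theta> * g"
      using remainder norm_triangle_sub[of "gradient f (cgd_step \<eta> f z)" lin] by linarith
    then have "(norm (gradient f (cgd_step \<eta> f z)))\<^sup>2 \<le> (norm lin + \<theta> * g)\<^sup>2"
      by (intro power_mono) auto
    also have "\<dots> = (norm lin)\<^sup>2 + 2 * (\<theta> * g) * norm lin + (\<theta> * g)\<^sup>2"
      by (simp add: power2_sum algebra_simps)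
    also have "\<dots> \<le> (1 - c) * g\<^sup>2 + 2 * \<theta> * g\<^sup>2 + \<theta>\<^sup>2 * g\<^sup>2"
    proof -
      have "(1 - c) * g\<^sup>2 \<le> 1 * g\<^sup>2"
        using c' \<theta>0 \<alpha> by (intro mult_right_mono) auto
      then have "(norm lin)\<^sup>2 \<le> g\<^sup>2" using lin2 by linarith
      then have "norm lin \<le> g" using g0 by (rule power2_le_imp_le)
      then have "(\<theta> * g) * norm lin \<le> (\<theta> * g) * g"
        using \<theta>0 g0 by (intro mult_left_mono) auto
      then show ?thesis using lin2 by (simp add: power2_eq_square algebra_simps)
    qed
    also have "\<dots> = (1 - c + 2 * \<theta> + \<theta>\<^sup>2) * g\<^sup>2" by (simp add: algebra_simps)
    also have "\<dots> \<le> (1 - \<alpha>) * g\<^sup>2"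
    proof (cases "g = 0")
      case False
      then have "0 < g\<^sup>2" using g0 by simp
      moreover have "0 \<le> (1 - c) * g\<^sup>2" using lin2 zero_le_power2[of "norm lin"] by linarith
      ultimately have "c \<le> 1" by (simp add: zero_le_mult_iff)
      then have "\<theta> \<le> 1" using c' \<alpha> by linarith
      then have "\<theta>\<^sup>2 \<le> \<theta>" using \<theta>0 by (simp add: power2_eq_square mult_left_le)
      then show ?thesis using c' by (intro mult_right_mono) auto
    qed simp
    finally show ?thesis by (simp add: g_def)
  qed
qed

section \<open>Convergence of the iteration\<close>

lemma convergent_if_geometric_steps:
  fixes X :: "nat \<Rightarrow> 'a::banach"
  assumes q: "0 \<le> q" "q < 1" and step: "\<And>k. norm (X (Suc k) - X k) \<le> c * q ^ k"
  shows "convergent X"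
proof -
  have "summable (\<lambda>k. c * q ^ k)" using q by (intro summable_mult summable_geometric) simp
  then have "summable (\<lambda>k. X (Suc k) - X k)"
    using step by (rule summable_comparison_test'[where N = 0])
  then have "convergent (\<lambda>n. \<Sum>k<n. X (Suc k) - X k)" by (simp add: summable_iff_convergent)
  then have "convergent (\<lambda>n. (X n - X 0) + X 0)"
    unfolding sum_lessThan_telescope by (intro convergent_add convergent_const)
  then show ?thesis by simp
qed

theorem corollary2p2p1:
  fixes f :: "(real^'m) \<times> (real^'n) \<Rightarrow> real"
    and x0 :: "real^'m" and y0 :: "real^'n"
    and L \<eta> \<alpha> :: real
  assumes "twice_differentiable f"
    and "lipschitz_hessian L f"
    and "\<eta> > 0"
    and "\<And>x y. \<eta> * spectral_norm (Dxx f (x, y)) \<le> 1 / 18"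
    and "\<And>x y. \<eta> * spectral_norm (Dyy f (x, y)) \<le> 1 / 18"
    and "\<alpha> > 0"
    and "\<And>x y. (2 * \<eta>) *\<^sub>R spectral_fun h_pm (Dxx f (x, y)) + (1 / 3) *\<^sub>R Dbar \<eta> f (x, y)
            - mat (32 * \<eta>\<^sup>2 * L * (norm (grad_x f (x0, y0)) + norm (grad_y f (x0, y0))))
            - mat (768 * \<eta> ^ 4 * L\<^sup>2) \<succeq> mat \<alpha>"
    and "\<And>x y. (2 * \<eta>) *\<^sub>R spectral_fun h_pm (- Dyy f (x, y)) + (1 / 3) *\<^sub>R Dtilde \<eta> f (x, y)
            - mat (32 * \<eta>\<^sup>2 * L * (norm (grad_x f (x0, y0)) + norm (grad_y f (x0, y0))))
            - mat (768 * \<eta> ^ 4 * L\<^sup>2) \<succeq> mat \<alpha>"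
  shows "\<exists>xs ys. (\<lambda>k. cgd \<eta> f (x0, y0) k) \<longlonglongrightarrow> (xs, ys)
           \<and> grad_x f (xs, ys) = 0 \<and> grad_y f (xs, ys) = 0
           \<and> (\<exists>C. \<forall>k. (norm (grad_x f (cgd \<eta> f (x0, y0) k)))\<^sup>2
                    + (norm (grad_y f (cgd \<eta> f (x0, y0) k)))\<^sup>2 \<le> C * exp (- \<alpha> * real k))"
proof -
  note f = assms(1) and L = assms(2) and eta = assms(3) and \<alpha> = assms(6)
  define X where "X = cgd \<eta> f (x0, y0)"
  define g where "g k = norm (gradient f (X k))" for k
  have X0: "X 0 = (x0, y0)" and XS: "X (Suc k) = cgd_step \<eta> f (X k)" for k
    by (simp_all add: X_def cgd_def)
  have grads: "grad_x f z = fst (gradient f z)" "grad_y f z = snd (gradient f z)" for z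
    using f grad_x_eq_fst_gradient grad_y_eq_snd_gradient unfolding twice_differentiable_def by blast+
  have L0: "0 \<le> L" using f L by (rule lipschitz_hessian_nonneg)
  define G where "G = norm (grad_x f (x0, y0)) + norm (grad_y f (x0, y0))"
  have g0: "g 0 \<le> G"
    unfolding g_def X0 G_def grads
    using norm_Pair_le[of "fst (gradient f (x0, y0))" "snd (gradient f (x0, y0))"] by simp
  define c where "c = \<alpha> + 32 * \<eta>\<^sup>2 * L * G + 768 * \<eta> ^ 4 * L\<^sup>2"
  have mat_add: "mat (a + b) = mat a + (mat b :: real^'k^'k)" for a b
    by (simp add: mat_def vec_eq_iff)
  have cx: "(2 * \<eta>) *\<^sub>R spectral_fun h_pm (Dxx f z) + (1 / 3) *\<^sub>R Dbar \<eta> f z \<succeq> mat c"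
    and cy: "(2 * \<eta>) *\<^sub>R spectral_fun h_pm (- Dyy f z) + (1 / 3) *\<^sub>R Dtilde \<eta> f z \<succeq> mat c" for z
    using assms(7)[of "fst z" "snd z"] assms(8)[of "fst z" "snd z"]
    unfolding loewner_ge_def c_def mat_add G_def
    by (simp_all add: algebra_simps)
  \<comment> \<open>the curvature condition refers to the initial gradient, so it controls the linearisation error
    as long as the gradient norm has not grown\<close>
  have step: "norm (X (Suc k) - X k) \<le> \<eta> * g k" "(g (Suc k))\<^sup>2 \<le> exp (- \<alpha>) * (g k)\<^sup>2"
    if "g k \<le> g 0" for k
  proof -
    have "\<eta>\<^sup>2 * L * g k \<le> \<eta>\<^sup>2 * L * G"
      using that g0 L0 by (intro mult_left_mono) auto
    moreover have "0 \<le> \<eta>\<^sup>2 * L * g k" using L0 by (simp add: g_def)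
    moreover have "0 \<le> 768 * \<eta> ^ 4 * L\<^sup>2" by simp
    ultimately have c: "\<alpha> + 3 * (\<eta>\<^sup>2 * L * norm (gradient f (X k))) \<le> c"
      unfolding c_def g_def by linarith
    have xx: "\<eta> * spectral_norm (Dxx f (X k)) \<le> 1 / 18"
      and yy: "\<eta> * spectral_norm (Dyy f (X k)) \<le> 1 / 18"
      using assms(4,5)[of "fst (X k)" "snd (X k)"] by simp_all
    note D = cgd_step_decrease[OF f L eta \<alpha> xx yy c cx cy]
    show "norm (X (Suc k) - X k) \<le> \<eta> * g k" using D(1) by (simp add: XS g_def)
    have "(g (Suc k))\<^sup>2 \<le> (1 - \<alpha>) * (g k)\<^sup>2" using D(2) by (simp add: XS g_def)
    also have "\<dots> \<le> exp (- \<alpha>) * (g k)\<^sup>2"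
      using exp_ge_add_one_self[of "- \<alpha>"] by (intro mult_right_mono) auto
    finally show "(g (Suc k))\<^sup>2 \<le> exp (- \<alpha>) * (g k)\<^sup>2" .
  qed
  have g_le: "g k \<le> g 0" if "(g k)\<^sup>2 \<le> (g 0)\<^sup>2 * exp (- \<alpha> * real k)" for k
  proof (rule power2_le_imp_le)
    have "(g 0)\<^sup>2 * exp (- \<alpha> * real k) \<le> (g 0)\<^sup>2 * 1"
      using \<alpha> by (intro mult_left_mono) auto
    then show "(g k)\<^sup>2 \<le> (g 0)\<^sup>2" using that by simp
  qed (simp add: g_def)
  have decay: "(g k)\<^sup>2 \<le> (g 0)\<^sup>2 * exp (- \<alpha> * real k)" for k
  proof (induction k)
    case (Suc k)
    have "(g (Suc k))\<^sup>2 \<le> exp (- \<alpha>) * (g k)\<^sup>2" using Suc by (intro step g_le)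
    also have "\<dots> \<le> exp (- \<alpha>) * ((g 0)\<^sup>2 * exp (- \<alpha> * real k))" using Suc by simp
    also have "\<dots> = (g 0)\<^sup>2 * exp (- \<alpha> * real (Suc k))"
      by (simp add: algebra_simps flip: exp_add)
    finally show ?case .
  qed simp
  define q where "q = exp (- \<alpha> / 2)"
  have q: "0 \<le> q" "q < 1" using \<alpha> by (simp_all add: q_def)
  have g_geom: "g k \<le> g 0 * q ^ k" for k
  proof (rule power2_le_imp_le)
    have "(q ^ k)\<^sup>2 = exp (- \<alpha> * real k)"
      by (simp add: q_def algebra_simps flip: exp_of_nat_mult exp_double)
    then show "(g k)\<^sup>2 \<le> (g 0 * q ^ k)\<^sup>2" using decay by (simp add: power_mult_distrib)
  qed (use q in \<open>simp add: g_def\<close>)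
  have "convergent X"
  proof (rule convergent_if_geometric_steps[OF q])
    fix k
    have "norm (X (Suc k) - X k) \<le> \<eta> * g k" using decay by (intro step g_le)
    also have "\<dots> \<le> \<eta> * (g 0 * q ^ k)" using g_geom eta by simp
    finally show "norm (X (Suc k) - X k) \<le> (\<eta> * g 0) * q ^ k" by (simp add: mult.assoc)
  qed
  then obtain z where z: "X \<longlonglongrightarrow> z" by (auto simp: convergent_def)
  have "gradient f z = 0"
  proof -
    have "isCont (gradient f) z"
      using gradient_has_derivative_hess[OF f] by (rule has_derivative_continuous)
    then have "(\<lambda>k. gradient f (X k)) \<longlonglongrightarrow> gradient f z" using z by (rule isCont_tendsto_compose)
    moreover have "(\<lambda>k. gradient f (X k)) \<longlonglongrightarrow> 0"
    proof (rule Lim_null_comparison)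
      show "\<forall>\<^sub>F k in sequentially. norm (gradient f (X k)) \<le> g 0 * q ^ k"
        using g_geom by (simp add: g_def)
      show "(\<lambda>k. g 0 * q ^ k) \<longlonglongrightarrow> 0"
        using q by (intro tendsto_mult_right_zero LIMSEQ_power_zero) simp
    qed
    ultimately show ?thesis by (rule LIMSEQ_unique)
  qed
  then have crit: "grad_x f (fst z, snd z) = 0" "grad_y f (fst z, snd z) = 0"
    by (simp_all add: grads)
  have "(norm (grad_x f (X k)))\<^sup>2 + (norm (grad_y f (X k)))\<^sup>2 \<le> (g 0)\<^sup>2 * exp (- \<alpha> * real k)" for k
    using decay[of k] by (simp add: grads g_def norm_prod_def)
  with z crit show ?thesis
    unfolding X_def by (metis prod.collapse)
qed

end
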